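(* For all grid sizes $M_x,M_y\ge2$, $N\ge1$ and all data $\varphi,\phi,f$, the implicit finite difference scheme (S) described in the context is uniquely solvable: there is exactly one family of grid functions $U^1,\ldots,U^N\in\mathcal V_h$ which, together with the prescribed $U^0$, satisfies (S) for all $1\le n\le N$, $1\le i\le M_x-1$, $1\le j\le M_y-1$.
   Context: Parameters: integers $p,q,s\ge1$; reals $a_l>0$ ($1\le l\le p$), $b_1,b_2,b_3>0$, $c_m>0$ ($1\le m\le q$), $d_r>0$ ($1\le r\le s$); orders $1<\gamma_l<2$, $0<\alpha_m<1$, $0<\beta_r<1$; $T,L_x,L_y>0$, $\Omega=(0,L_x)\times(0,L_y)$. The scheme discretizes the problem $$\sum_{l}a_lD_t^{\gamma_l}u+b_1u_t+\sum_m c_mD_t^{\alpha_m}u+b_2u=b_3(u_{xx}+u_{yy})+\sum_r d_rD_t^{\beta_r}(u_{xx}+u_{yy})+f$$ on $\Omega\times(0,T]$ with Caputo time derivatives, $u(x,y,0)=\varphi$, $u_t(x,y,0)=\phi$, and $u=0$ on $\partial\Omega$. Grid: $h_x=L_x/M_x$, $h_y=L_y/M_y$, $\tau=T/N$, $x_i=ih_x$, $y_j=jh_y$, $t_n=n\tau$. $\mathcal V_h$ is the space of real grid functions $v=(v_{ij})_{0\le i\le M_x,0\le j\le M_y}$ with $v_{0j}=v_{M_xj}=v_{i0}=v_{iM_y}=0$. Notation: $\nabla_tv^n_{ij}=(v^n_{ij}-v^{n-1}_{ij})/\tau$, $v^{n-\frac12}_{ij}=(v^n_{ij}+v^{n-1}_{ij})/2$,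 $\delta_x^2v_{ij}=(v_{i-1,j}-2v_{ij}+v_{i+1,j})/h_x^2$, $\delta_y^2v_{ij}=(v_{i,j-1}-2v_{ij}+v_{i,j+1})/h_y^2$, $f^n_{ij}=f(x_i,y_j,t_n)$, $\phi_{ij}=\phi(x_i,y_j)$, $\varphi_{ij}=\varphi(x_i,y_j)$. Coefficients: $\mu_{1,l}=\tau^{1-\gamma_l}/\Gamma(3-\gamma_l)$, $\mu_{2,m}=\tau^{1-\alpha_m}/\Gamma(2-\alpha_m)$, $\mu_{3,r}=\tau^{1-\beta_r}/\Gamma(2-\beta_r)$. For $\gamma\in(1,2)$, $a_k^{(\gamma)}=(k+1)^{2-\gamma}-k^{2-\gamma}$, $k\ge0$. For $\alpha\in(0,1)$: $\tilde a_0^{(\alpha)}=(\tfrac12)^{1-\alpha}$ and, for $k\ge1$, $\tilde a_k^{(\alpha)}=(k+\tfrac12)^{1-\alpha}-(k-\tfrac12)^{1-\alpha}$, $\tilde b_k^{(\alpha)}=\frac1{2-\alpha}[(k+\tfrac12)^{2-\alpha}-(k-\tfrac12)^{2-\alpha}]-\frac12[(k+\tfrac12)^{1-\alpha}+(k-\tfrac12)^{1-\alpha}]$; $c_0^{(1,\alpha)}=\tilde a_0^{(\alpha)}$, and for $n\ge2$: $c_0^{(n,\alpha)}=\tilde a_0^{(\alpha)}+\tilde b_1^{(\alpha)}$, $c_k^{(n,\alpha)}=\tilde a_k^{(\alpha)}+\tilde b_{k+1}^{(\alpha)}-\tilde b_k^{(\alpha)}$ ($1\le k\le n-2$), $c_{n-1}^{(n,\alpha)}=\tilde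 a_{n-1}^{(\alpha)}-\tilde b_{n-1}^{(\alpha)}$. Scheme (S): for $1\le n\le N$, $1\le i\le M_x-1$, $1\le j\le M_y-1$, $$\sum_{l=1}^{p}a_l\mu_{1,l}\Big[a_0^{(\gamma_l)}\nabla_tU_{ij}^{n}-\sum_{k=1}^{n-1}(a_{n-k-1}^{(\gamma_l)}-a_{n-k}^{(\gamma_l)})\nabla_tU_{ij}^{k}-a_{n-1}^{(\gamma_l)}\phi_{ij}\Big]+b_1\nabla_tU_{ij}^{n}+\sum_{m=1}^qc_m\mu_{2,m}\sum_{k=1}^n c_{n-k}^{(n,\alpha_m)}\nabla_tU_{ij}^k+b_2U_{ij}^{n-\frac12}$$ $$=b_3(\delta_x^2+\delta_y^2)U_{ij}^{n-\frac12}+\sum_{r=1}^sd_r\mu_{3,r}\sum_{k=1}^n c_{n-k}^{(n,\beta_r)}\nabla_t(\delta_x^2+\delta_y^2)U_{ij}^k+f_{ij}^{n-\frac12},$$ with $U^0_{ij}=\varphi_{ij}$ on the grid ($\varphi$ vanishing on $\partial\Omega$) and $U^n\in\mathcal V_h$ for $1\le n\le N$. *)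

theory Defs
  imports "HOL-Analysis.Analysis"
begin

text \<open>
  A grid function is indexed by \<open>(i, j)\<close> with \<open>0 \<le> i \<le> Mx\<close>, \<open>0 \<le> j \<le> My\<close>. It is represented by a
  total function on pairs of naturals that is zero outside this index range, so that equality of
  representatives is equality on the grid.
\<close>

definition grid_space :: "nat \<Rightarrow> nat \<Rightarrow> (nat \<Rightarrow> nat \<Rightarrow> real) set" where
  "grid_space Mx My =
     {v. (\<forall>i j. i > Mx \<or> j > My \<longrightarrow> v i j = 0) \<and>
         (\<forall>j\<le>My. v 0 j = 0 \<and> v Mx j = 0) \<and>
         (\<forall>i\<le>Mx. v i 0 = 0 \<and> v i My = 0)}"

text \<open>
  The next two operators act on sequences of grid functions and are meant for time levels \<open>n \<ge> 1\<close>;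
  the two spatial ones are meant for interior indices, so subtraction on naturals never truncates.
\<close>

definition time_diff :: "real \<Rightarrow> (nat \<Rightarrow> nat \<Rightarrow> nat \<Rightarrow> real) \<Rightarrow> nat \<Rightarrow> nat \<Rightarrow> nat \<Rightarrow> real" where
  "time_diff \<tau> v n i j = (v n i j - v (n - 1) i j) / \<tau>"

definition half_step :: "(nat \<Rightarrow> nat \<Rightarrow> nat \<Rightarrow> real) \<Rightarrow> nat \<Rightarrow> nat \<Rightarrow> nat \<Rightarrow> real" where
  "half_step v n i j = (v n i j + v (n - 1) i j) / 2"

definition delta_x2 :: "real \<Rightarrow> (nat \<Rightarrow> nat \<Rightarrow> real) \<Rightarrow> nat \<Rightarrow> nat \<Rightarrow> real" where
  "delta_x2 hx v i j = (v (i - 1) j - 2 * v i j + v (i + 1) j) / hx\<^sup>2"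

definition delta_y2 :: "real \<Rightarrow> (nat \<Rightarrow> nat \<Rightarrow> real) \<Rightarrow> nat \<Rightarrow> nat \<Rightarrow> real" where
  "delta_y2 hy v i j = (v i (j - 1) - 2 * v i j + v i (j + 1)) / hy\<^sup>2"

definition discrete_laplace ::
    "real \<Rightarrow> real \<Rightarrow> (nat \<Rightarrow> nat \<Rightarrow> real) \<Rightarrow> nat \<Rightarrow> nat \<Rightarrow> real" where
  "discrete_laplace hx hy v i j = delta_x2 hx v i j + delta_y2 hy v i j"

definition mu_wave :: "real \<Rightarrow> real \<Rightarrow> real" where
  "mu_wave \<tau> \<gamma> = \<tau> powr (1 - \<gamma>) / Gamma (3 - \<gamma>)"

definition mu_sub :: "real \<Rightarrow> real \<Rightarrow> real" where
  "mu_sub \<tau> \<alpha> = \<tau> powr (1 - \<alpha>) / Gamma (2 - \<alpha>)"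

definition a_coeff :: "real \<Rightarrow> nat \<Rightarrow> real" where
  "a_coeff \<gamma> k = (real k + 1) powr (2 - \<gamma>) - real k powr (2 - \<gamma>)"

definition a_tilde :: "real \<Rightarrow> nat \<Rightarrow> real" where
  "a_tilde \<alpha> k =
     (if k = 0 then (1/2) powr (1 - \<alpha>)
      else (real k + 1/2) powr (1 - \<alpha>) - (real k - 1/2) powr (1 - \<alpha>))"

text \<open>Meant for \<open>k \<ge> 1\<close> only.\<close>

definition b_tilde :: "real \<Rightarrow> nat \<Rightarrow> real" where
  "b_tilde \<alpha> k =
     1 / (2 - \<alpha>) * ((real k + 1/2) powr (2 - \<alpha>) - (real k - 1/2) powr (2 - \<alpha>))
     - 1/2 * ((real k + 1/2) powr (1 - \<alpha>) + (real k - 1/2) powr (1 - \<alpha>))"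

text \<open>Meant for \<open>0 \<le> k \<le> n - 1\<close> only; the last branch is the case \<open>k = n - 1 \<ge> 1\<close>.\<close>

definition c_coeff :: "nat \<Rightarrow> real \<Rightarrow> nat \<Rightarrow> real" where
  "c_coeff n \<alpha> k =
     (if k = 0 then (if n = 1 then a_tilde \<alpha> 0 else a_tilde \<alpha> 0 + b_tilde \<alpha> 1)
      else if k + 2 \<le> n then a_tilde \<alpha> k + b_tilde \<alpha> (k + 1) - b_tilde \<alpha> k
      else a_tilde \<alpha> k - b_tilde \<alpha> k)"

text \<open>
  Discrete Caputo derivative of order \<open>\<gamma> \<in> (1, 2)\<close> at the half level \<open>n - 1/2\<close>; \<open>w\<close> holds the grid
  values of the initial velocity.
\<close>

definition caputo_wave ::
    "real \<Rightarrow> real \<Rightarrow> (nat \<Rightarrow> nat \<Rightarrow> real) \<Rightarrow> (nat \<Rightarrow> nat \<Rightarrow> nat \<Rightarrow> real) \<Rightarrow> nat \<Rightarrow> nat \<Rightarrow> nat \<Rightarrow> real" where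
  "caputo_wave \<tau> \<gamma> w v n i j =
     mu_wave \<tau> \<gamma> *
       (a_coeff \<gamma> 0 * time_diff \<tau> v n i j
        - (\<Sum>k = 1..n - 1. (a_coeff \<gamma> (n - k - 1) - a_coeff \<gamma> (n - k)) * time_diff \<tau> v k i j)
        - a_coeff \<gamma> (n - 1) * w i j)"

text \<open>Discrete Caputo derivative of order \<open>\<alpha> \<in> (0, 1)\<close> at the half level \<open>n - 1/2\<close>.\<close>

definition caputo_sub ::
    "real \<Rightarrow> real \<Rightarrow> (nat \<Rightarrow> nat \<Rightarrow> nat \<Rightarrow> real) \<Rightarrow> nat \<Rightarrow> nat \<Rightarrow> nat \<Rightarrow> real" where
  "caputo_sub \<tau> \<alpha> v n i j =
     mu_sub \<tau> \<alpha> * (\<Sum>k = 1..n. c_coeff n \<alpha> (n - k) * time_diff \<tau> v k i j)"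

end

theory Submission
  imports Defs "HOL-Probability.Discrete_Topology"
begin

text \<open>
  The unknowns of time level \<open>n\<close> enter (S) through \<open>A x - B \<Delta>\<^sub>h x = G\<close>, where \<open>G\<close> depends on the data
  and the earlier levels only, and \<open>A > 0\<close>, \<open>B \<ge> 0\<close> because the leading coefficients \<open>a\<^sub>0\<close> and \<open>c\<^sub>0\<close>
  are positive. Solved for the diagonal entry, this is a fixed point equation \<open>x = S x\<close> in which
  \<open>S\<close> (a Jacobi step) contracts in the maximum norm, so Banach's theorem gives a unique solution.
  Induction on the levels concludes.
\<close>

section \<open>Positivity of the leading coefficients\<close>

text \<open>The negative terms of \<open>b_tilde \<alpha> 1\<close> are absorbed once everything is
  expressed through the powers of 1/2 and 3/2 with exponent \<open>1 - \<alpha>\<close>: the sum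
  with \<open>a_tilde \<alpha> 0\<close> combines these two powers with positive weights.\<close>

lemma c_coeff_0_pos:
  assumes "0 < \<alpha>" "\<alpha> < 1"
  shows "c_coeff n \<alpha> 0 > 0"
proof -
  define P where "P = (1/2::real) powr (1 - \<alpha>)"
  define Q where "Q = (3/2::real) powr (1 - \<alpha>)"
  have pos: "P > 0" "Q > 0"
    by (simp_all add: P_def Q_def)
  have "(1/2::real) powr (1 + (1 - \<alpha>)) = 1/2 * P" "(3/2::real) powr (1 + (1 - \<alpha>)) = 3/2 * Q"
    unfolding powr_add P_def Q_def by simp_all
  then have powrs: "(1/2::real) powr (2 - \<alpha>) = P / 2" "(3/2::real) powr (2 - \<alpha>) = 3/2 * Q"
    by simp_all
  have "a_tilde \<alpha> 0 + b_tilde \<alpha> 1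
      = P * ((1 - \<alpha>) / (2 * (2 - \<alpha>))) + Q * ((1 + \<alpha>) / (2 * (2 - \<alpha>)))"
    using \<open>\<alpha> < 1\<close>
    by (simp add: a_tilde_def b_tilde_def powrs flip: P_def Q_def)
      (simp add: divide_simps, simp add: algebra_simps)
  also have "\<dots> > 0"
    using assms pos by (intro add_pos_pos mult_pos_pos divide_pos_pos) auto
  finally show ?thesis
    using pos by (simp add: c_coeff_def a_tilde_def P_def)
qed

lemma mu_wave_pos: "\<tau> > 0 \<Longrightarrow> \<gamma> < 2 \<Longrightarrow> mu_wave \<tau> \<gamma> > 0"
  by (simp add: mu_wave_def Gamma_real_pos)

lemma mu_sub_pos: "\<tau> > 0 \<Longrightarrow> \<alpha> < 1 \<Longrightarrow> mu_sub \<tau> \<alpha> > 0"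
  by (simp add: mu_sub_def Gamma_real_pos)

section \<open>The discrete Helmholtz problem of one time level\<close>

text \<open>Merges padding outside the grid and boundary values into one support condition, the form
  in which the Jacobi map below handles them.\<close>

lemma grid_space_iff:
  "v \<in> grid_space Mx My \<longleftrightarrow> (\<forall>i j. \<not> (i \<in> {1..Mx - 1} \<and> j \<in> {1..My - 1}) \<longrightarrow> v i j = 0)"
proof
  assume v: "v \<in> grid_space Mx My"
  show "\<forall>i j. \<not> (i \<in> {1..Mx - 1} \<and> j \<in> {1..My - 1}) \<longrightarrow> v i j = 0"
  proof (intro allI impI)
    fix i j assume "\<not> (i \<in> {1..Mx - 1} \<and> j \<in> {1..My - 1})"
    then have "i > Mx \<or> j > My \<or> (j \<le> My \<and> (i = 0 \<or> i = Mx)) \<or> (i \<le> Mx \<and> (j = 0 \<or> j = My))"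
      by auto
    then show "v i j = 0"
      using v unfolding grid_space_def by blast
  qed
next
  assume v: "\<forall>i j. \<not> (i \<in> {1..Mx - 1} \<and> j \<in> {1..My - 1}) \<longrightarrow> v i j = 0"
  have "v i j = 0" if "i > Mx \<or> j > My \<or> i = 0 \<or> i = Mx \<or> j = 0 \<or> j = My" for i j
    using that by (intro v[rule_format]) auto
  then show "v \<in> grid_space Mx My"
    by (simp add: grid_space_def)
qed

text \<open>Strict diagonal dominance: in each row the diagonal entry exceeds the total weight
  \<open>2 * P + 2 * Q\<close> of the four neighbours by \<open>A\<close>.\<close>

lemma ex1_grid_helmholtz:
  fixes A B hx hy :: real and g :: "nat \<Rightarrow> nat \<Rightarrow> real"
  assumes A: "A > 0" and B: "B \<ge> 0"
  shows "\<exists>!v. v \<in> grid_space Mx My \<and>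
    (\<forall>i\<in>{1..Mx - 1}. \<forall>j\<in>{1..My - 1}. A * v i j - B * discrete_laplace hx hy v i j = g i j)"
proof -
  define P where "P = B / hx\<^sup>2"
  define Q where "Q = B / hy\<^sup>2"
  define D where "D = A + 2 * P + 2 * Q"
  have PQ: "P \<ge> 0" "Q \<ge> 0" using B by (simp_all add: P_def Q_def)
  have D: "D > 0" "2 * P + 2 * Q < D" using A PQ by (simp_all add: D_def)
  define I where "I = {1..Mx - 1} \<times> {1..My - 1}"
  \<comment> \<open>The zero branch builds the boundary condition into the map: every fixed point
    vanishes outside \<open>I\<close>, although \<open>S x\<close> may read nonzero neighbour values
    of a general \<open>x\<close>.\<close>
  define S where "S x = (\<lambda>(i, j). if (i, j) \<in> I
      then (g i j + P * (x (i - 1, j) + x (i + 1, j)) + Q * (x (i, j - 1) + x (i, j + 1))) / D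
      else 0)" for x :: "nat \<times> nat \<Rightarrow> real"
  have S_support: "\<forall>z. z \<notin> I \<longrightarrow> S x z = 0" for x
    by (auto simp: S_def)
  \<comment> \<open>\<open>S x\<close> is bounded even for unbounded \<open>x\<close>, since it
    takes only finitely many values; continuity is automatic on a discrete space.\<close>
  have S_bcontfun: "S x \<circ> of_discrete \<in> bcontfun" for x
  proof -
    have "range (S x \<circ> of_discrete) \<subseteq> insert 0 (S x ` I)"
      using S_support by fastforce
    moreover have "finite I"
      by (simp add: I_def)
    ultimately have "bounded (range (S x \<circ> of_discrete))"
      by (meson bounded_subset finite_imageI finite_imp_bounded finite_insert)
    moreover have "continuous_on UNIV (S x \<circ> of_discrete)"
      by (simp add: continuous_on_open_vimage open_discrete)
    ultimately show ?thesis
      by (simp add: bcontfun_def)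
  qed
  \<comment> \<open>Phrased with a bound \<open>C\<close> instead of a norm, so that it speaks of
    plain functions; it is applied with \<open>C\<close> the distance of two bounded
    functions.\<close>
  have contraction: "\<bar>S x z - S y z\<bar> \<le> (2 * P + 2 * Q) / D * C"
    if "\<And>z. \<bar>x z - y z\<bar> \<le> C" for x y z C
  proof (cases "z \<in> I")
    case True
    obtain i j where z: "z = (i, j)" by fastforce
    define e where "e z = x z - y z" for z
    have e: "\<bar>e z\<bar> \<le> C" for z using that by (simp add: e_def)
    have "S x z - S y z
        = (P * (e (i - 1, j) + e (i + 1, j)) + Q * (e (i, j - 1) + e (i, j + 1))) / D"
      using True by (simp add: S_def z e_def diff_divide_distrib[symmetric] algebra_simps)
    also have "\<bar>\<dots>\<bar> = \<bar>P * (e (i - 1, j) + e (i + 1, j)) + Q * (e (i, j - 1) + e (i, j + 1))\<bar> / D"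
      using D by simp
    also have "\<dots> \<le> (P * (C + C) + Q * (C + C)) / D"
    proof (intro divide_right_mono order_trans[OF abs_triangle_ineq] add_mono)
      have "\<bar>e a + e b\<bar> \<le> C + C" for a b
        using e[of a] e[of b] by linarith
      then show "\<bar>P * (e (i - 1, j) + e (i + 1, j))\<bar> \<le> P * (C + C)"
        "\<bar>Q * (e (i, j - 1) + e (i, j + 1))\<bar> \<le> Q * (C + C)"
        using PQ by (simp_all only: abs_mult abs_of_nonneg mult_left_mono)
    qed (use D in simp)
    finally show ?thesis by (simp add: algebra_simps)
  next
    case False
    have "0 \<le> C" using that abs_ge_zero order_trans by blast
    moreover have "S x z = 0" "S y z = 0" using False S_support by blast+
    ultimately show ?thesis using PQ D by simp
  qed
  \<comment> \<open>Passing to the discrete copy of the index type makes the bounded functions a complete space.\<close>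
  define G :: "(nat \<times> nat) discrete \<Rightarrow>\<^sub>C real \<Rightarrow> (nat \<times> nat) discrete \<Rightarrow>\<^sub>C real"
    where "G x = Bcontfun (S (apply_bcontfun x \<circ> discrete) \<circ> of_discrete)" for x
  have apply_G: "apply_bcontfun (G x) = S (apply_bcontfun x \<circ> discrete) \<circ> of_discrete" for x
    unfolding G_def by (rule Bcontfun_inverse[OF S_bcontfun])
  have "\<exists>!x. G x = x"
  proof (rule banach_fix_type)
    show "0 \<le> (2 * P + 2 * Q) / D" "(2 * P + 2 * Q) / D < 1"
      using PQ D by simp_all
    show "\<forall>x y. dist (G x) (G y) \<le> (2 * P + 2 * Q) / D * dist x y"
    proof (intro allI dist_bound)
      fix x y :: "(nat \<times> nat) discrete \<Rightarrow>\<^sub>C real" and z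
      have "\<bar>apply_bcontfun x (discrete u) - apply_bcontfun y (discrete u)\<bar> \<le> dist x y" for u
        using dist_bounded[of x "discrete u" y] by (simp add: dist_real_def)
      then show "dist (apply_bcontfun (G x) z) (apply_bcontfun (G y) z)
          \<le> (2 * P + 2 * Q) / D * dist x y"
        using contraction[of "apply_bcontfun x \<circ> discrete" "apply_bcontfun y \<circ> discrete" "dist x y"]
        by (simp add: apply_G dist_real_def)
    qed
  qed
  then obtain x where x: "G x = x" and x_unique: "\<And>y. G y = y \<Longrightarrow> y = x"
    by blast
  have ex1_fixpoint: "\<exists>!y. S y = y"
  proof (rule ex1I[of _ "apply_bcontfun x \<circ> discrete"])
    show "S (apply_bcontfun x \<circ> discrete) = apply_bcontfun x \<circ> discrete"
      using apply_G[of x] by (simp add: x fun_eq_iff discrete_inverse)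
  next
    \<comment> \<open>Banach's theorem compares bounded functions only, but any fixed point
      \<open>y\<close> equals \<open>S y\<close> and is therefore bounded.\<close>
    fix y assume y: "S y = y"
    have "apply_bcontfun (Bcontfun (y \<circ> of_discrete)) = y \<circ> of_discrete"
      using Bcontfun_inverse[OF S_bcontfun[of y]] by (simp add: y)
    then have y_eq: "apply_bcontfun (Bcontfun (y \<circ> of_discrete)) \<circ> discrete = y"
      by (simp add: fun_eq_iff discrete_inverse)
    have "Bcontfun (y \<circ> of_discrete) = x"
      by (rule x_unique) (simp add: G_def y_eq y)
    then show "y = apply_bcontfun x \<circ> discrete"
      using y_eq by simp
  qed
  have solution_iff: "v \<in> grid_space Mx My \<and>
      (\<forall>i\<in>{1..Mx - 1}. \<forall>j\<in>{1..My - 1}. A * v i j - B * discrete_laplace hx hy v i j = g i j)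
    \<longleftrightarrow> S (case_prod v) = case_prod v" for v
  proof -
    have B_laplace: "B * discrete_laplace hx hy v i j
        = P * (v (i - 1) j - 2 * v i j + v (i + 1) j) + Q * (v i (j - 1) - 2 * v i j + v i (j + 1))"
      for i j
      by (simp add: discrete_laplace_def delta_x2_def delta_y2_def P_def Q_def algebra_simps
          add_divide_distrib diff_divide_distrib)
    \<comment> \<open>Multiplying the fixed point equation by \<open>D\<close> and moving the
      neighbour terms to the other side recovers the difference equation.\<close>
    have interior: "A * v i j - B * discrete_laplace hx hy v i j = g i j
        \<longleftrightarrow> S (case_prod v) (i, j) = v i j" if "(i, j) \<in> I" for i j
      using that D unfolding B_laplace
      by (simp add: S_def divide_eq_eq) (simp add: D_def algebra_simps, linarith)
    have exterior: "v i j = 0 \<longleftrightarrow> S (case_prod v) (i, j) = v i j" if "(i, j) \<notin> I" for i j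
      using that S_support by (metis (no_types))
    have mem_I: "i \<in> {1..Mx - 1} \<and> j \<in> {1..My - 1} \<longleftrightarrow> (i, j) \<in> I" for i j
      by (simp add: I_def)
    have "v \<in> grid_space Mx My \<and>
        (\<forall>i\<in>{1..Mx - 1}. \<forall>j\<in>{1..My - 1}. A * v i j - B * discrete_laplace hx hy v i j = g i j)
      \<longleftrightarrow> (\<forall>i j. (i, j) \<notin> I \<longrightarrow> v i j = 0) \<and>
        (\<forall>i j. (i, j) \<in> I \<longrightarrow> A * v i j - B * discrete_laplace hx hy v i j = g i j)"
      unfolding grid_space_iff mem_I[symmetric] by blast
    also have "\<dots> \<longleftrightarrow> (\<forall>i j. S (case_prod v) (i, j) = v i j)"
      using interior exterior by blast
    also have "\<dots> \<longleftrightarrow> S (case_prod v) = case_prod v"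
      by (simp add: fun_eq_iff)
    finally show ?thesis .
  qed
  show ?thesis
    unfolding solution_iff
    using ex1_fixpoint by (metis case_prod_curry curry_case_prod)
qed

section \<open>Affine dependence of the difference operators on the current level\<close>

text \<open>Pattern of the update lemmas: the value with level \<open>n\<close> set to zero is known
  data, the rest is linear in the unknown \<open>x\<close>. The condition \<open>n \<ge> 1\<close>
  keeps level \<open>n - 1\<close> distinct from \<open>n\<close>.\<close>

lemma time_diff_update:
  "n \<ge> 1 \<Longrightarrow> time_diff \<tau> (V(n := x)) n i j = time_diff \<tau> (V(n := \<lambda>_ _. 0)) n i j + x i j / \<tau>"
  by (simp add: time_diff_def diff_divide_distrib)

lemma half_step_update:
  "n \<ge> 1 \<Longrightarrow> half_step (V(n := x)) n i j = half_step (V(n := \<lambda>_ _. 0)) n i j + x i j / 2"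
  by (simp add: half_step_def add_divide_distrib)

lemma time_diff_cong:
  "V k = V' k \<Longrightarrow> V (k - 1) = V' (k - 1) \<Longrightarrow> time_diff \<tau> V k = time_diff \<tau> V' k"
  by (simp add: time_diff_def fun_eq_iff)

text \<open>The history sum stops at \<open>n - 1\<close>, so only the leading difference sees
  \<open>x\<close>; its weight \<open>a_coeff \<gamma> 0\<close> equals 1 and drops out.\<close>

lemma caputo_wave_update:
  assumes "n \<ge> 1"
  shows "caputo_wave \<tau> \<gamma> w (V(n := x)) n i j
    = caputo_wave \<tau> \<gamma> w (V(n := \<lambda>_ _. 0)) n i j + mu_wave \<tau> \<gamma> / \<tau> * x i j"
proof -
  have "time_diff \<tau> (V(n := x)) k = time_diff \<tau> (V(n := \<lambda>_ _. 0)) k" if "k \<in> {1..n - 1}" for k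
    using that by (intro time_diff_cong) auto
  then show ?thesis
    using assms
    by (simp add: caputo_wave_def time_diff_update[of n _ V x] a_coeff_def algebra_simps)
qed

text \<open>Only the summand \<open>k = n\<close> involves \<open>x\<close>, which leaves the
  coefficient with index 0.\<close>

lemma caputo_sub_update:
  assumes "n \<ge> 1"
  shows "caputo_sub \<tau> \<alpha> (V(n := x)) n i j
    = caputo_sub \<tau> \<alpha> (V(n := \<lambda>_ _. 0)) n i j + mu_sub \<tau> \<alpha> * c_coeff n \<alpha> 0 / \<tau> * x i j"
proof -
  have split: "{1..n} = insert n {1..n - 1}" "n \<notin> {1..n - 1}" using assms by auto
  have "time_diff \<tau> (V(n := x)) k = time_diff \<tau> (V(n := \<lambda>_ _. 0)) k" if "k \<in> {1..n - 1}" for k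
    using that by (intro time_diff_cong) auto
  then show ?thesis
    using split(2) assms unfolding caputo_sub_def split(1)
    by (simp add: time_diff_update[of n _ V x] distrib_left)
qed

lemma discrete_laplace_half_step_update:
  assumes "n \<ge> 1"
  shows "discrete_laplace hx hy (half_step (V(n := x)) n) i j
    = discrete_laplace hx hy (half_step (V(n := \<lambda>_ _. 0)) n) i j + discrete_laplace hx hy x i j / 2"
proof -
  have "half_step (V(n := x)) n = (\<lambda>i j. half_step (V(n := \<lambda>_ _. 0)) n i j + x i j / 2)"
    using half_step_update[OF assms] by blast
  then show ?thesis
    by (simp add: discrete_laplace_def delta_x2_def delta_y2_def add_divide_distrib
        diff_divide_distrib del: fun_upd_apply)
qed

text \<open>Lets \<open>caputo_sub_update\<close> act on the sequence of Laplacians, whose new value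
  at level \<open>n\<close> is the Laplacian of \<open>x\<close>.\<close>

lemma discrete_laplace_update:
  "(\<lambda>k. discrete_laplace hx hy ((V(n := x)) k))
    = (\<lambda>k. discrete_laplace hx hy (V k))(n := discrete_laplace hx hy x)"
  by auto

lemma discrete_laplace_0: "discrete_laplace hx hy (\<lambda>_ _. 0) = (\<lambda>_ _. 0)"
  by (simp add: discrete_laplace_def delta_x2_def delta_y2_def fun_eq_iff)

section \<open>Marching through the time levels\<close>

text \<open>By \<open>causal\<close>, choosing a later level cannot disturb earlier equations, so
  the levels are determined one after another. The extensional function space fixes the values
  outside \<open>{1..N}\<close>, which makes uniqueness an equality of functions; the initial level
  \<open>u\<close> is inserted separately.\<close>

lemma ex1_PiE_levels:
  fixes Q :: "nat \<Rightarrow> (nat \<Rightarrow> 'a) \<Rightarrow> bool"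
  assumes step: "\<And>n V. n \<in> {1..N} \<Longrightarrow> \<exists>!x. x \<in> S \<and> Q n (V(n := x))"
    and causal: "\<And>n V V'. n \<in> {1..N} \<Longrightarrow> (\<And>k. k \<le> n \<Longrightarrow> V k = V' k) \<Longrightarrow> Q n V = Q n V'"
  shows "\<exists>!U. U \<in> {1..N} \<rightarrow>\<^sub>E S \<and> (\<forall>n\<in>{1..N}. Q n (U(0 := u)))"
  using assms
proof (induction N)
  case 0
  show ?case by simp
next
  case (Suc N)
  let ?P = "\<lambda>N U. U \<in> {1..N} \<rightarrow>\<^sub>E S \<and> (\<forall>n\<in>{1..N}. Q n (U(0 := u)))"
  have "\<exists>!U. ?P N U"
  proof (rule Suc.IH)
    fix n and V V' :: "nat \<Rightarrow> 'a"
    assume "n \<in> {1..N}"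
    then have n: "n \<in> {1..Suc N}" by simp
    show "\<exists>!x. x \<in> S \<and> Q n (V(n := x))"
      using n by (rule Suc.prems(1))
    show "Q n V = Q n V'" if "\<And>k. k \<le> n \<Longrightarrow> V k = V' k"
      using n that by (rule Suc.prems(2))
  qed
  then obtain U where U: "?P N U" and U_unique: "\<And>W. ?P N W \<Longrightarrow> W = U"
    by (elim ex1E) (rule that, assumption, iprover)
  have "\<exists>!x. x \<in> S \<and> Q (Suc N) ((U(0 := u))(Suc N := x))"
    by (rule Suc.prems(1)) simp
  then obtain x where x: "x \<in> S" "Q (Suc N) ((U(0 := u))(Suc N := x))"
    and x_unique: "\<And>y. y \<in> S \<Longrightarrow> Q (Suc N) ((U(0 := u))(Suc N := y)) \<Longrightarrow> y = x"
    by (elim ex1E) (rule that; iprover)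
  have atLeastAtMost_Suc: "{1..Suc N} = insert (Suc N) {1..N}" by auto
  show ?case
  proof (rule ex1I[of _ "U(Suc N := x)"])
    have "Q n ((U(Suc N := x))(0 := u))" if "n \<in> {1..N}" for n
    proof -
      have "Q n ((U(Suc N := x))(0 := u)) = Q n (U(0 := u))"
        by (rule Suc.prems(2)) (use that in auto)
      then show ?thesis using U that by blast
    qed
    moreover have "Q (Suc N) ((U(Suc N := x))(0 := u))"
      using x(2) by (simp add: fun_upd_twist)
    moreover have "U(Suc N := x) \<in> {1..Suc N} \<rightarrow>\<^sub>E S"
      unfolding atLeastAtMost_Suc using U x(1) by (intro PiE_fun_upd) blast+
    ultimately show "?P (Suc N) (U(Suc N := x))"
      unfolding atLeastAtMost_Suc by blast
  next
    fix W assume W: "?P (Suc N) W"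
    \<comment> \<open>Resetting the last level to the extensional default yields a solution for
      \<open>N\<close> levels, to which the uniqueness from the induction hypothesis
      applies.\<close>
    let ?W = "W(Suc N := undefined)"
    have "Q n (?W(0 := u))" if "n \<in> {1..N}" for n
    proof -
      have "Q n (?W(0 := u)) = Q n (W(0 := u))"
        by (rule Suc.prems(2)) (use that in auto)
      then show ?thesis using W that by simp
    qed
    moreover have "?W \<in> {1..N} \<rightarrow>\<^sub>E S"
      using W by (auto simp: PiE_iff extensional_def)
    ultimately have "?W = U" by (intro U_unique) blast
    then have W_eq: "W = U(Suc N := W (Suc N))" by auto
    have "Q (Suc N) (W(0 := u))" using W by simp
    then have "Q (Suc N) ((U(0 := u))(Suc N := W (Suc N)))"
      by (subst (asm) W_eq) (simp add: fun_upd_twist)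
    moreover have "W (Suc N) \<in> S" using W by auto
    ultimately show "W = U(Suc N := x)" using x_unique W_eq by metis
  qed
qed

section \<open>Unique solvability of the scheme\<close>

theorem theorem5p1:
  fixes p q s Mx My N :: nat
    and a c d \<gamma> \<alpha> \<beta> :: "nat \<Rightarrow> real"
    and b1 b2 b3 T Lx Ly hx hy \<tau> :: real
    and \<phi>0 \<phi>1 :: "real \<Rightarrow> real \<Rightarrow> real"
    and f :: "real \<Rightarrow> real \<Rightarrow> real \<Rightarrow> real"
  assumes "p \<ge> 1" and "q \<ge> 1" and "s \<ge> 1"
    and "\<And>l. l \<in> {1..p} \<Longrightarrow> a l > 0"
    and "b1 > 0" and "b2 > 0" and "b3 > 0"
    and "\<And>m. m \<in> {1..q} \<Longrightarrow> c m > 0"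
    and "\<And>r. r \<in> {1..s} \<Longrightarrow> d r > 0"
    and "\<And>l. l \<in> {1..p} \<Longrightarrow> 1 < \<gamma> l \<and> \<gamma> l < 2"
    and "\<And>m. m \<in> {1..q} \<Longrightarrow> 0 < \<alpha> m \<and> \<alpha> m < 1"
    and "\<And>r. r \<in> {1..s} \<Longrightarrow> 0 < \<beta> r \<and> \<beta> r < 1"
    and "T > 0" and "Lx > 0" and "Ly > 0"
    and "Mx \<ge> 2" and "My \<ge> 2" and "N \<ge> 1"
    and "hx = Lx / real Mx" and "hy = Ly / real My" and "\<tau> = T / real N"
    and "\<And>x y. (x, y) \<in> frontier ({0<..<Lx} \<times> {0<..<Ly}) \<Longrightarrow> \<phi>0 x y = 0"
  shows "\<exists>!U. U \<in> {1..N} \<rightarrow>\<^sub>E grid_space Mx My \<and>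
    (let V = U(0 := (\<lambda>i j. \<phi>0 (real i * hx) (real j * hy)));
         w = (\<lambda>i j. \<phi>1 (real i * hx) (real j * hy));
         F = (\<lambda>n i j. f (real i * hx) (real j * hy) (real n * \<tau>))
     in \<forall>n\<in>{1..N}. \<forall>i\<in>{1..Mx - 1}. \<forall>j\<in>{1..My - 1}.
          (\<Sum>l = 1..p. a l * caputo_wave \<tau> (\<gamma> l) w V n i j)
          + b1 * time_diff \<tau> V n i j
          + (\<Sum>m = 1..q. c m * caputo_sub \<tau> (\<alpha> m) V n i j)
          + b2 * half_step V n i j
        = b3 * discrete_laplace hx hy (half_step V n) i j
          + (\<Sum>r = 1..s. d r *
               caputo_sub \<tau> (\<beta> r) (\<lambda>k. discrete_laplace hx hy (V k)) n i j)
          + half_step F n i j)"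
proof -
  define w where "w = (\<lambda>i j. \<phi>1 (real i * hx) (real j * hy))"
  define F where "F = (\<lambda>n i j. f (real i * hx) (real j * hy) (real n * \<tau>))"
  define E where "E n V i j \<longleftrightarrow>
      (\<Sum>l = 1..p. a l * caputo_wave \<tau> (\<gamma> l) w V n i j) + b1 * time_diff \<tau> V n i j
        + (\<Sum>m = 1..q. c m * caputo_sub \<tau> (\<alpha> m) V n i j) + b2 * half_step V n i j
      = b3 * discrete_laplace hx hy (half_step V n) i j
        + (\<Sum>r = 1..s. d r * caputo_sub \<tau> (\<beta> r) (\<lambda>k. discrete_laplace hx hy (V k)) n i j)
        + half_step F n i j" for n V i j
  define Q where "Q n V \<longleftrightarrow> (\<forall>i\<in>{1..Mx - 1}. \<forall>j\<in>{1..My - 1}. E n V i j)" for n V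
  have \<tau>: "\<tau> > 0" using assms by simp
  have step: "\<exists>!x. x \<in> grid_space Mx My \<and> Q n (V(n := x))" if "n \<in> {1..N}" for n V
  proof -
    have n: "n \<ge> 1" using that by simp
    \<comment> \<open>\<open>A\<close> and \<open>B\<close> gather all factors multiplying
      \<open>x\<close> and its Laplacian at level \<open>n\<close>; the halves come from averaging
      two levels.\<close>
    define A where "A = (\<Sum>l = 1..p. a l * (mu_wave \<tau> (\<gamma> l) / \<tau>)) + b1 / \<tau>
        + (\<Sum>m = 1..q. c m * (mu_sub \<tau> (\<alpha> m) * c_coeff n (\<alpha> m) 0 / \<tau>)) + b2 / 2"
    define B where "B = b3 / 2
        + (\<Sum>r = 1..s. d r * (mu_sub \<tau> (\<beta> r) * c_coeff n (\<beta> r) 0 / \<tau>))"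
    have "0 \<le> (\<Sum>l = 1..p. a l * (mu_wave \<tau> (\<gamma> l) / \<tau>))"
      using assms \<tau> by (intro sum_nonneg) (simp add: mu_wave_pos less_imp_le)
    moreover have "0 \<le> (\<Sum>m = 1..q. c m * (mu_sub \<tau> (\<alpha> m) * c_coeff n (\<alpha> m) 0 / \<tau>))"
      using assms \<tau> by (intro sum_nonneg) (simp add: mu_sub_pos c_coeff_0_pos less_imp_le)
    ultimately have A: "A > 0"
      unfolding A_def using \<open>b1 > 0\<close> \<open>b2 > 0\<close> \<tau> by (simp add: add_nonneg_pos add_nonneg_nonneg)
    have "0 \<le> (\<Sum>r = 1..s. d r * (mu_sub \<tau> (\<beta> r) * c_coeff n (\<beta> r) 0 / \<tau>))"
      using assms \<tau> by (intro sum_nonneg) (simp add: mu_sub_pos c_coeff_0_pos less_imp_le)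
    then have B: "B \<ge> 0"
      unfolding B_def using \<open>b3 > 0\<close> by simp
    let ?V0 = "V(n := \<lambda>_ _. 0)"
    \<comment> \<open>The right side minus the left side of (S) with level \<open>n\<close> replaced
      by zero, hence free of the unknown.\<close>
    define g where "g i j =
        b3 * discrete_laplace hx hy (half_step ?V0 n) i j
        + (\<Sum>r = 1..s. d r * caputo_sub \<tau> (\<beta> r) (\<lambda>k. discrete_laplace hx hy (?V0 k)) n i j)
        + half_step F n i j
        - ((\<Sum>l = 1..p. a l * caputo_wave \<tau> (\<gamma> l) w ?V0 n i j) + b1 * time_diff \<tau> ?V0 n i j
          + (\<Sum>m = 1..q. c m * caputo_sub \<tau> (\<alpha> m) ?V0 n i j) + b2 * half_step ?V0 n i j)" for i j
    have E_update: "E n (V(n := x)) i j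
        \<longleftrightarrow> A * x i j - B * discrete_laplace hx hy x i j = g i j" for x i j
    proof -
      have wave: "(\<Sum>l = 1..p. a l * caputo_wave \<tau> (\<gamma> l) w (V(n := x)) n i j)
          = (\<Sum>l = 1..p. a l * caputo_wave \<tau> (\<gamma> l) w ?V0 n i j)
            + (\<Sum>l = 1..p. a l * (mu_wave \<tau> (\<gamma> l) / \<tau>)) * x i j"
        unfolding caputo_wave_update[OF n, of _ _ _ V x]
        by (simp only: distrib_left sum.distrib sum_distrib_right mult.assoc)
      \<comment> \<open>Stated for a general sequence \<open>W\<close> because it serves twice: for
        \<open>V\<close> with new value \<open>x\<close>, and for its Laplacians with new value the
        Laplacian of \<open>x\<close>.\<close>
      have sub: "(\<Sum>m = 1..k. e m * caputo_sub \<tau> (\<epsilon> m) (W(n := y)) n i j)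
          = (\<Sum>m = 1..k. e m * caputo_sub \<tau> (\<epsilon> m) (W(n := \<lambda>_ _. 0)) n i j)
            + (\<Sum>m = 1..k. e m * (mu_sub \<tau> (\<epsilon> m) * c_coeff n (\<epsilon> m) 0 / \<tau>)) * y i j"
        for k :: nat and e \<epsilon> W y
        unfolding caputo_sub_update[OF n, of _ _ W y]
        by (simp only: distrib_left sum.distrib sum_distrib_right mult.assoc)
      show ?thesis
        unfolding E_def g_def A_def B_def discrete_laplace_update discrete_laplace_0 wave
          sub[where y = x] sub[where y = "discrete_laplace hx hy x"]
          time_diff_update[OF n, of _ V x] half_step_update[OF n, of V x]
          discrete_laplace_half_step_update[OF n, of _ _ V x]
        by (simp only: distrib_left distrib_right times_divide_eq_left times_divide_eq_right) linarith
    qed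
    have "Q n (V(n := x)) \<longleftrightarrow> (\<forall>i\<in>{1..Mx - 1}. \<forall>j\<in>{1..My - 1}.
        A * x i j - B * discrete_laplace hx hy x i j = g i j)" for x
      unfolding Q_def by (intro ball_cong refl E_update)
    then show ?thesis
      by (simp only: ex1_grid_helmholtz[OF A B])
  qed
  \<comment> \<open>Every operator in the equation of level \<open>n\<close> reads the sequence at
    levels up to \<open>n\<close> only.\<close>
  have causal: "Q n V = Q n V'" if "n \<in> {1..N}" and eq: "\<And>k. k \<le> n \<Longrightarrow> V k = V' k" for n V V'
  proof -
    have diff: "time_diff \<tau> V k = time_diff \<tau> V' k"
      "time_diff \<tau> (\<lambda>k. discrete_laplace hx hy (V k)) k
        = time_diff \<tau> (\<lambda>k. discrete_laplace hx hy (V' k)) k" if "k \<le> n" for k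
      using that eq by (intro time_diff_cong; simp)+
    have diff_pred: "time_diff \<tau> V k = time_diff \<tau> V' k" if "k \<le> n - 1" for k
      using that by (intro diff) simp
    have half: "half_step V n = half_step V' n"
      using eq by (simp add: half_step_def fun_eq_iff)
    have wave: "caputo_wave \<tau> g w V n = caputo_wave \<tau> g w V' n" for g
      by (simp add: caputo_wave_def fun_eq_iff diff diff_pred)
    have sub: "caputo_sub \<tau> g V n = caputo_sub \<tau> g V' n"
      "caputo_sub \<tau> g (\<lambda>k. discrete_laplace hx hy (V k)) n
        = caputo_sub \<tau> g (\<lambda>k. discrete_laplace hx hy (V' k)) n" for g
      by (simp_all add: caputo_sub_def fun_eq_iff diff)
    show ?thesis
      unfolding Q_def E_def by (simp only: diff[OF order_refl] half wave sub)
  qed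
  show ?thesis
    using ex1_PiE_levels[of N "grid_space Mx My" Q, OF step causal]
    unfolding Let_def Q_def E_def w_def F_def .
qed

end
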